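(* Let $K$ be an algebraically closed field, let $d\ge 0$ and $n\ge d+1$ be integers, and consider the polynomial ring over $K$ in the variables $P_J$, $J\in\binom{[n]}{d}$, and $q_I$, $I\in\binom{[n]}{d+1}$. Let $\mathcal{I}$ be the ideal generated by all codimension-1 incidence relations $$I_{D,E}=\sum_{i\in E\setminus D}(-1)^{|[i]\cap D|+|[i]\cap E|}\,q_{E\setminus\{i\}}\,P_{D\cup\{i\}},\qquad D,E\subset[n],\ |D|=d-1,\ |E|=d+2.$$ Then the Plücker relations are in the saturation of $\mathcal{I}$. More precisely, for any fixed $C\in\binom{[n]}{d+1}$ and all $A\in\binom{[n]}{d-1}$, $B\in\binom{[n]}{d+1}$, the Plücker relation $$R_{A,B}=\sum_{i\in B\setminus A}(-1)^{|[i]\cap A|+|[i]\cap B|}\,P_{A\cup\{i\}}\,P_{B\setminus\{i\}}$$ satisfies $R_{A,B}\in(\mathcal{I}:\langle q_C\rangle^\infty)$.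
   Context: $[n]=\{1,\dots,n\}$ and $\binom{[n]}{m}$ is the set of $m$-element subsets of $[n]$. For an ideal $\mathcal I$ of a commutative ring and a ring element $q$, the saturation $(\mathcal I:\langle q\rangle^\infty)$ is the ideal of all ring elements $f$ such that $q^N f\in\mathcal I$ for some integer $N\ge 0$. The $q_I$ are treated as independent variables. *)

theory Defs
  imports
    "HOL-Library.Poly_Mapping"
    "HOL-Computational_Algebra.Polynomial"
    "HOL-Algebra.Ideal"
begin

type_synonym ('v, 'k) mvpoly = "('v \<Rightarrow>\<^sub>0 nat) \<Rightarrow>\<^sub>0 'k"

definition var :: "'v \<Rightarrow> ('v, 'k::comm_ring_1) mvpoly"
  where "var v = Poly_Mapping.single (Poly_Mapping.single v 1) 1"

definition vars :: "('v, 'k::zero) mvpoly \<Rightarrow> 'v set"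
  where "vars f = (\<Union>m\<in>Poly_Mapping.keys f. Poly_Mapping.keys m)"

text \<open>A dependent type of variables is not available, so the polynomial ring in the
  variables \<open>V\<close> is carved out of the polynomial ring over a larger type of variables.\<close>

definition poly_ring :: "'v set \<Rightarrow> ('v, 'k::comm_ring_1) mvpoly ring"
  where "poly_ring V =
    \<lparr>carrier = {f. vars f \<subseteq> V}, monoid.mult = (*), one = 1, ring.zero = 0, add = (+)\<rparr>"

definition saturation :: "('a, 'm) ring_scheme \<Rightarrow> 'a set \<Rightarrow> 'a \<Rightarrow> 'a set"
  where "saturation R I q =
    {f \<in> carrier R. \<exists>N::nat. (q [^]\<^bsub>R\<^esub> N) \<otimes>\<^bsub>R\<^esub> f \<in> I}"

text \<open>The cardinality is an integer so that there are no subsets of cardinality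
  \<open>d - 1\<close> when \<open>d = 0\<close>.\<close>

definition subsets_of_card :: "nat \<Rightarrow> int \<Rightarrow> nat set set"
  where "subsets_of_card n m = {S. S \<subseteq> {1..n} \<and> int (card S) = m}"

datatype coord = Pc "nat set" | Qc "nat set"

definition coords :: "nat \<Rightarrow> nat \<Rightarrow> coord set"
  where "coords n d = Pc ` subsets_of_card n (int d) \<union> Qc ` subsets_of_card n (int d + 1)"

definition rel_sign :: "nat \<Rightarrow> nat set \<Rightarrow> nat set \<Rightarrow> 'a::comm_ring_1"
  where "rel_sign i S T = (- 1) ^ (card ({1..i} \<inter> S) + card ({1..i} \<inter> T))"

definition incidence_rel :: "nat set \<Rightarrow> nat set \<Rightarrow> (coord, 'k::comm_ring_1) mvpoly"
  where "incidence_rel D E =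
    (\<Sum>i\<in>E - D. rel_sign i D E * var (Qc (E - {i})) * var (Pc (D \<union> {i})))"

definition plucker_rel :: "nat set \<Rightarrow> nat set \<Rightarrow> (coord, 'k::comm_ring_1) mvpoly"
  where "plucker_rel A B =
    (\<Sum>i\<in>B - A. rel_sign i A B * var (Pc (A \<union> {i})) * var (Pc (B - {i})))"

definition incidence_rels :: "nat \<Rightarrow> nat \<Rightarrow> (coord, 'k::comm_ring_1) mvpoly set"
  where "incidence_rels n d =
    {incidence_rel D E | D E.
      D \<in> subsets_of_card n (int d - 1) \<and> E \<in> subsets_of_card n (int d + 2)}"

definition incidence_ideal :: "nat \<Rightarrow> nat \<Rightarrow> (coord, 'k::comm_ring_1) mvpoly set"
  where "incidence_ideal n d = genideal (poly_ring (coords n d)) (incidence_rels n d)"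

text \<open>\<^const>\<open>genideal\<close> only behaves as intended in a ring and for generators in its carrier.\<close>

lemma vars_0 [simp]: "vars 0 = {}"
  and vars_1 [simp]: "vars (1 :: ('v, 'k::comm_ring_1) mvpoly) = {}"
  and vars_var: "vars (var v :: ('v, 'k) mvpoly) = {v}"
  and vars_uminus [simp]: "vars (- f :: ('v, 'k) mvpoly) = vars f"
  by (simp_all add: vars_def var_def)

lemma vars_add: "vars (f + g) \<subseteq> vars f \<union> vars (g :: ('v, 'k::comm_ring_1) mvpoly)"
  using Poly_Mapping.keys_add[of f g] by (auto simp: vars_def)

lemma vars_mult: "vars (f * g) \<subseteq> vars f \<union> vars (g :: ('v, 'k::comm_ring_1) mvpoly)"
proof
  fix v assume "v \<in> vars (f * g)"
  then obtain m where m: "m \<in> Poly_Mapping.keys (f * g)" "v \<in> Poly_Mapping.keys m"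
    by (auto simp: vars_def)
  then obtain a b where "m = a + b" "a \<in> Poly_Mapping.keys f" "b \<in> Poly_Mapping.keys g"
    using Poly_Mapping.keys_mult[of f g] by blast
  with m(2) show "v \<in> vars f \<union> vars g"
    using Poly_Mapping.keys_add[of a b] by (auto simp: vars_def)
qed

lemma vars_sum:
  "(\<And>i. i \<in> S \<Longrightarrow> vars (f i) \<subseteq> V) \<Longrightarrow> vars (\<Sum>i\<in>S. f i :: ('v, 'k::comm_ring_1) mvpoly) \<subseteq> V"
proof (induction S rule: infinite_finite_induct)
  case (insert i S)
  then have "vars (f i) \<subseteq> V" "vars (sum f S) \<subseteq> V" by auto
  then show ?case using insert.hyps vars_add[of "f i" "sum f S"] by auto
qed auto

lemma vars_rel_sign [simp]: "vars (rel_sign i S T :: ('v, 'k::comm_ring_1) mvpoly) = {}"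
  by (cases "even (card ({1..i} \<inter> S) + card ({1..i} \<inter> T))") (simp_all add: rel_sign_def)

lemma cring_poly_ring: "cring (poly_ring V :: ('v, 'k::comm_ring_1) mvpoly ring)"
proof -
  let ?R = "poly_ring V :: ('v, 'k) mvpoly ring"
  have add: "vars (f + g) \<subseteq> V" and mult: "vars (f * g) \<subseteq> V"
    if "vars f \<subseteq> V" "vars g \<subseteq> V" for f g :: "('v, 'k) mvpoly"
    using that vars_add[of f g] vars_mult[of f g] by blast+
  have "abelian_group ?R"
  proof (rule abelian_groupI)
    fix f assume "f \<in> carrier ?R"
    then show "\<exists>g\<in>carrier ?R. g \<oplus>\<^bsub>?R\<^esub> f = \<zero>\<^bsub>?R\<^esub>"
      by (intro bexI[of _ "- f"]) (simp_all add: poly_ring_def)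
  qed (simp_all add: poly_ring_def add add_ac)
  moreover have "comm_monoid ?R"
    by (rule comm_monoidI) (simp_all add: poly_ring_def mult mult_ac)
  ultimately show ?thesis
    by (rule cringI) (simp add: poly_ring_def distrib_right)
qed

lemma incidence_rels_closed:
  "(incidence_rels n d :: (coord, 'k::comm_ring_1) mvpoly set) \<subseteq> carrier (poly_ring (coords n d))"
proof -
  have "vars (incidence_rel D E :: (coord, 'k) mvpoly) \<subseteq> coords n d"
    if D: "D \<in> subsets_of_card n (int d - 1)" and E: "E \<in> subsets_of_card n (int d + 2)" for D E
    unfolding incidence_rel_def
  proof (rule vars_sum)
    fix i assume i: "i \<in> E - D"
    have "finite D" "finite E"
      using D E by (auto simp: subsets_of_card_def intro: finite_subset)
    then have "int (card (insert i D)) = int d" "int (card (E - {i})) = int d + 1"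
      using D E i by (simp_all add: subsets_of_card_def card_Diff_singleton)
    then have P: "Pc (D \<union> {i}) \<in> coords n d" and Q: "Qc (E - {i}) \<in> coords n d"
      using D E i unfolding coords_def subsets_of_card_def by blast+
    let ?q = "var (Qc (E - {i})) :: (coord, 'k) mvpoly"
    let ?p = "var (Pc (D \<union> {i})) :: (coord, 'k) mvpoly"
    have "vars (rel_sign i D E * ?q * ?p) \<subseteq> vars ?q \<union> vars ?p"
      using vars_mult[of "rel_sign i D E * ?q" ?p] vars_mult[of "rel_sign i D E" ?q]
      unfolding vars_rel_sign by blast
    also have "\<dots> \<subseteq> coords n d"
      using P Q by (simp only: vars_var) blast
    finally show "vars (rel_sign i D E * ?q * ?p) \<subseteq> coords n d" .
  qed
  then show ?thesis unfolding incidence_rels_def poly_ring_def by fastforce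
qed

end

theory Submission
  imports Defs
begin

text \<open>Regard \<open>P\<close> and \<open>q\<close> as elements of the exterior algebra and write \<open>\<iota>\<^sub>i\<close> and \<open>\<epsilon>\<^sub>i\<close> for contraction
  and exterior multiplication by the \<open>i\<close>-th basis vector. The incidence and Pluecker relations are
  the coefficients of \<open>\<Sum>\<^sub>i \<iota>\<^sub>i P \<otimes> \<epsilon>\<^sub>i q\<close> and \<open>\<Sum>\<^sub>i \<iota>\<^sub>i P \<otimes> \<epsilon>\<^sub>i P\<close>. For \<open>j \<notin> C\<close>, the incidence relations
  with \<open>E = C \<union> {j}\<close> say that the operator \<open>\<delta>\<^sub>j = q\<^sub>C \<iota>\<^sub>j - \<Sum>\<^sub>c m\<^sub>j\<^sub>c \<iota>\<^sub>c\<close> (\<open>c\<close> ranging over \<open>C\<close>) kills \<open>P\<close>, for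
  suitable coefficients \<open>m\<^sub>j\<^sub>c\<close>. By the Clifford relations, \<open>\<delta>\<^sub>j\<close> applied to either factor then
  also kills \<open>\<Sum>\<^sub>i \<iota>\<^sub>i P \<otimes> \<epsilon>\<^sub>i P\<close>. Up to powers of \<open>q\<^sub>C\<close>, this allows the elements of \<open>A\<close> and \<open>B\<close>
  outside \<open>C\<close> to be exchanged for elements of \<open>C\<close>; and for \<open>A \<subseteq> C = B\<close> the Pluecker relation has just
  two terms, which cancel.\<close>

section \<open>Signed contraction and exterior multiplication in coordinates\<close>

definition sgn_at :: "nat \<Rightarrow> nat set \<Rightarrow> 'a::comm_ring_1"
  where "sgn_at i S = (- 1) ^ card ({1..i} \<inter> S)"

definition contract :: "nat \<Rightarrow> (nat set \<Rightarrow> 'a) \<Rightarrow> nat set \<Rightarrow> 'a::comm_ring_1"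
  where "contract i f D = (if i \<in> D then 0 else sgn_at i D * f (insert i D))"

text \<open>The sign at \<open>E\<close> counts \<open>i\<close> itself, as in the relations. For
  \<open>i \<ge> 1\<close> this is therefore minus left multiplication by the basis vector, whence
  the last minus sign in \<open>contract_ext_mult\<close>.\<close>

definition ext_mult :: "nat \<Rightarrow> (nat set \<Rightarrow> 'a) \<Rightarrow> nat set \<Rightarrow> 'a::comm_ring_1"
  where "ext_mult i f E = (if i \<in> E then sgn_at i E * f (E - {i}) else 0)"

definition pairing ::
  "nat \<Rightarrow> (nat set \<Rightarrow> 'a) \<Rightarrow> (nat set \<Rightarrow> 'a) \<Rightarrow> nat set \<Rightarrow> nat set \<Rightarrow> 'a::comm_ring_1"
  where "pairing n f g D E = (\<Sum>i\<in>{1..n}. contract i f D * ext_mult i g E)"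

definition contract_comb ::
  "'a \<Rightarrow> (nat \<Rightarrow> nat \<Rightarrow> 'a) \<Rightarrow> nat set \<Rightarrow> nat \<Rightarrow> (nat set \<Rightarrow> 'a) \<Rightarrow> nat set \<Rightarrow> 'a::comm_ring_1"
  where "contract_comb q m C j f D = q * contract j f D - (\<Sum>c\<in>C. m j c * contract c f D)"

section \<open>Sign rules and Clifford relations\<close>

lemma sgn_at_square [simp]: "sgn_at i S * sgn_at i S = 1"
  by (simp add: sgn_at_def flip: power_mult_distrib)

lemma sgn_at_square_left [simp]: "sgn_at i S * (sgn_at i S * x) = x"
  by (simp flip: mult.assoc)

text \<open>The intervals start at \<open>1\<close>, so inserting \<open>0\<close> leaves every sign
  alone; hence the bounds \<open>\<ge> 1\<close> below.\<close>

lemma sgn_at_insert: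
  assumes "j \<notin> S"
  shows "sgn_at i (insert j S) = (if 1 \<le> j \<and> j \<le> i then - sgn_at i S else sgn_at i S)"
  using assms by (auto simp: sgn_at_def Int_insert_right)

lemma sgn_at_remove:
  assumes "j \<in> S"
  shows "sgn_at i (S - {j}) = (if 1 \<le> j \<and> j \<le> i then - sgn_at i S else sgn_at i S)"
proof -
  obtain T where "S = insert j T" "j \<notin> T" using assms by (rule Set.set_insert)
  then show ?thesis by (simp add: sgn_at_insert)
qed

lemma rel_sign_eq: "rel_sign i S T = sgn_at i S * sgn_at i T"
  by (simp add: rel_sign_def sgn_at_def power_add)

text \<open>For distinct \<open>i\<close> and \<open>j\<close>, inserting the smaller index flips
  the sign at the larger one and not conversely, so exactly one of the two orders picks up a minus
  sign.\<close>

lemma contract_anticommute: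
  assumes "i \<ge> 1" "j \<ge> 1"
  shows "contract i (contract j f) D = - contract j (contract i f) D"
proof (cases "i = j")
  case True
  then show ?thesis by (simp add: contract_def)
next
  case False
  then show ?thesis
    using assms by (auto simp: contract_def sgn_at_insert insert_commute mult_ac)
qed

text \<open>For \<open>i = j\<close> at most one of the two products is nonzero at \<open>D\<close>,
  depending on whether \<open>i \<in> D\<close>; for distinct indices the signs compare as in
  \<open>contract_anticommute\<close>.\<close>

lemma contract_ext_mult:
  assumes "i \<ge> 1" "j \<ge> 1"
  shows "contract j (ext_mult i f) D = - ext_mult i (contract j f) D - (if i = j then f D else 0)"
proof (cases "i = j")
  case True
  then show ?thesis using assms
    by (auto simp: contract_def ext_mult_def sgn_at_insert sgn_at_remove insert_absorb)
next
  case False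
  then have "insert j D - {i} = insert j (D - {i})" by auto
  with False show ?thesis using assms
    by (auto simp: contract_def ext_mult_def sgn_at_insert sgn_at_remove mult_ac)
qed

lemma contract_sum: "contract j (\<lambda>D. \<Sum>i\<in>I. g i D) D = (\<Sum>i\<in>I. contract j (g i) D)"
  by (simp add: contract_def sum_distrib_left)

lemma contract_mult_right: "contract j (\<lambda>D. g D * x) D = contract j g D * x"
  by (simp add: contract_def mult_ac)

lemma contract_mult_left: "contract j (\<lambda>D. x * g D) D = x * contract j g D"
  by (simp add: contract_def mult_ac)

section \<open>Combinations of contractions acting on the pairing\<close>

lemma contract_comb_sum:
  "contract_comb q m C j (\<lambda>D. \<Sum>i\<in>I. g i D) D = (\<Sum>i\<in>I. contract_comb q m C j (g i) D)"
  unfolding contract_comb_def contract_sum sum_distrib_left sum_subtractf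
  by (subst sum.swap) simp

lemma contract_comb_mult_right:
  "contract_comb q m C j (\<lambda>D. g D * x) D = contract_comb q m C j g D * x"
  by (simp add: contract_comb_def contract_mult_right left_diff_distrib sum_distrib_right mult.assoc)

lemma contract_comb_mult_left:
  "contract_comb q m C j (\<lambda>D. x * g D) D = x * contract_comb q m C j g D"
  by (simp add: contract_comb_def contract_mult_left right_diff_distrib sum_distrib_left mult.left_commute)

lemma contract_comb_contract:
  assumes "i \<ge> 1" "j \<ge> 1" "\<And>c. c \<in> C \<Longrightarrow> c \<ge> 1"
  shows "contract_comb q m C j (contract i f) D = - contract i (contract_comb q m C j f) D"
proof -
  have "contract_comb q m C j (contract i f) D
      = - (q * contract i (contract j f) D - (\<Sum>c\<in>C. m j c * contract i (contract c f) D))"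
    using assms by (simp add: contract_comb_def contract_anticommute[of _ i] sum_negf)
  also have "q * contract i (contract j f) D - (\<Sum>c\<in>C. m j c * contract i (contract c f) D)
      = contract i (contract_comb q m C j f) D"
    by (simp add: contract_def[of i] contract_comb_def right_diff_distrib sum_distrib_left mult_ac)
  finally show ?thesis .
qed

text \<open>By linearity from \<open>contract_ext_mult\<close>: the correction is \<open>f D\<close>
  times the coefficient of \<open>contract i\<close> in the combination.\<close>

lemma contract_comb_ext_mult:
  assumes "i \<ge> 1" "j \<ge> 1" "\<And>c. c \<in> C \<Longrightarrow> c \<ge> 1"
  shows "contract_comb q m C j (ext_mult i f) D = - ext_mult i (contract_comb q m C j f) D
    - (q * (if i = j then f D else 0) - (\<Sum>c\<in>C. m j c * (if i = c then f D else 0)))"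
proof -
  have "contract_comb q m C j (ext_mult i f) D
      = - (q * ext_mult i (contract j f) D - (\<Sum>c\<in>C. m j c * ext_mult i (contract c f) D))
        - (q * (if i = j then f D else 0) - (\<Sum>c\<in>C. m j c * (if i = c then f D else 0)))"
    using assms
    by (simp add: contract_comb_def contract_ext_mult right_diff_distrib sum_negf sum_subtractf
        algebra_simps)
  also have "q * ext_mult i (contract j f) D - (\<Sum>c\<in>C. m j c * ext_mult i (contract c f) D)
      = ext_mult i (contract_comb q m C j f) D"
    by (simp add: ext_mult_def contract_comb_def right_diff_distrib sum_distrib_left mult_ac)
  finally show ?thesis .
qed

lemma contract_comb_pairing_left:
  assumes "j \<ge> 1" "C \<subseteq> {1..n}"
  shows "contract_comb q m C j (\<lambda>D. pairing n f g D E) D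
    = - pairing n (contract_comb q m C j f) g D E"
proof -
  have "contract_comb q m C j (contract i f) D = - contract i (contract_comb q m C j f) D"
    if "i \<in> {1..n}" for i
    using assms that by (intro contract_comb_contract) auto
  then show ?thesis
    unfolding pairing_def contract_comb_sum contract_comb_mult_right
    by (simp add: sum_negf)
qed

text \<open>Weighted by \<open>contract i f D\<close> and summed over \<open>i\<close>, the
  corrections from \<open>contract_comb_ext_mult\<close> reassemble to the combination applied to
  \<open>f\<close>. If it kills \<open>f\<close> and \<open>g\<close>, it thus kills the
  pairing.\<close>

lemma contract_comb_pairing_right:
  assumes "j \<in> {1..n}" "C \<subseteq> {1..n}"
  shows "contract_comb q m C j (pairing n f g D) E
    = - pairing n f (contract_comb q m C j g) D E - contract_comb q m C j f D * g E"
proof -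
  have "finite C" using assms(2) by (rule finite_subset) simp
  let ?r = "\<lambda>i. q * (if i = j then g E else 0) - (\<Sum>c\<in>C. m j c * (if i = c then g E else 0))"
  have step: "contract_comb q m C j (ext_mult i g) E
      = - ext_mult i (contract_comb q m C j g) E - ?r i" if "i \<in> {1..n}" for i
    using assms that by (intro contract_comb_ext_mult) auto
  \<comment> \<open>After swapping the sums only \<open>i = c\<close> survives, and this index
    occurs since \<open>C \<subseteq> {1..n}\<close>.\<close>
  have "(\<Sum>i\<in>{1..n}. contract i f D * (\<Sum>c\<in>C. m j c * (if i = c then g E else 0)))
      = (\<Sum>c\<in>C. \<Sum>i\<in>{1..n}. if i = c then m j c * contract i f D * g E else 0)"
    unfolding sum_distrib_left
    by (subst sum.swap) (intro sum.cong refl, auto)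
  also have "\<dots> = (\<Sum>c\<in>C. m j c * contract c f D * g E)"
    using assms(2) by (intro sum.cong refl) auto
  finally have C: "(\<Sum>i\<in>{1..n}. contract i f D * (\<Sum>c\<in>C. m j c * (if i = c then g E else 0)))
      = (\<Sum>c\<in>C. m j c * contract c f D * g E)" .
  have "(\<Sum>i\<in>{1..n}. contract i f D * (q * (if i = j then g E else 0)))
      = (\<Sum>i\<in>{1..n}. if i = j then q * contract i f D * g E else 0)"
    by (intro sum.cong refl) auto
  also have "\<dots> = q * contract j f D * g E" using assms(1) by simp
  finally have r: "(\<Sum>i\<in>{1..n}. contract i f D * ?r i) = contract_comb q m C j f D * g E"
    by (simp only: right_diff_distrib sum_subtractf C)
      (simp add: contract_comb_def left_diff_distrib sum_distrib_right)
  have "contract_comb q m C j (pairing n f g D) E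
      = contract_comb q m C j (\<lambda>E. \<Sum>i\<in>{1..n}. contract i f D * ext_mult i g E) E"
    by (simp add: pairing_def[abs_def])
  also have "\<dots> = (\<Sum>i\<in>{1..n}. contract i f D * (- ext_mult i (contract_comb q m C j g) E - ?r i))"
    unfolding contract_comb_sum contract_comb_mult_left by (intro sum.cong refl) (simp only: step)
  also have "\<dots> = - pairing n f (contract_comb q m C j g) D E - (\<Sum>i\<in>{1..n}. contract i f D * ?r i)"
    by (simp only: pairing_def right_diff_distrib mult_minus_right sum_subtractf sum_negf)
  finally show ?thesis by (simp only: r)
qed

section \<open>The relations as coefficients of the pairing, and the case of subsets of
  \<open>C\<close>\<close>

lemma pairing_eq_sum:
  assumes "E \<subseteq> {1..n}"
  shows "pairing n f g D E
    = (\<Sum>i\<in>E - D. rel_sign i D E * g (E - {i}) * f (D \<union> {i}))"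
proof -
  have "pairing n f g D E = (\<Sum>i\<in>E - D. contract i f D * ext_mult i g E)"
    unfolding pairing_def using assms
    by (intro sum.mono_neutral_right) (auto simp: contract_def ext_mult_def)
  also have "\<dots> = (\<Sum>i\<in>E - D. rel_sign i D E * g (E - {i}) * f (D \<union> {i}))"
    by (intro sum.cong refl) (auto simp: contract_def ext_mult_def rel_sign_eq mult_ac)
  finally show ?thesis .
qed

text \<open>For other sizes of \<open>A\<close> or \<open>B\<close> each product has a vanishing
  factor. Otherwise \<open>B = C\<close> and \<open>C - A\<close> has two elements, giving two terms
  that cancel.\<close>

lemma pairing_self_eq_0:
  assumes f: "\<And>S. card S \<noteq> d \<Longrightarrow> f S = 0"
    and C: "C \<subseteq> {1..n}" "card C = d + 1"
    and AB: "A \<subseteq> C" "B \<subseteq> C"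
  shows "pairing n f f A B = 0"
proof (cases "card A + 1 = d \<and> card B = d + 1")
  case False
  have fin: "finite A" "finite B" using assms by (meson finite_atLeastAtMost finite_subset)+
  have "f (B - {i}) * f (A \<union> {i}) = 0" if "i \<in> B - A" for i
  proof -
    have "card (A \<union> {i}) = card A + 1" "card (B - {i}) + 1 = card B"
      using that fin card_Suc_Diff1[of B i] by auto
    then show ?thesis using False f[of "B - {i}"] f[of "A \<union> {i}"] by fastforce
  qed
  then show ?thesis using assms
    by (subst pairing_eq_sum) (auto simp: mult.assoc intro!: sum.neutral)
next
  case True
  have fin: "finite C" using C(1) by (rule finite_subset) simp
  have "B = C" using fin AB True C by (intro card_subset_eq) auto
  have "card (C - A) = 2"
    using fin AB True C by (auto simp: card_Diff_subset finite_subset)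
  then obtain x y where xy: "C - A = {x, y}" "x \<noteq> y" by (auto simp: card_2_iff)
  then have Ceq: "C = insert x (insert y A)" and nA: "x \<notin> A" "y \<notin> A" using AB by auto
  have "x \<ge> 1" "y \<ge> 1" using Ceq C(1) by auto
  moreover have "C - {x} = A \<union> {y}" "C - {y} = A \<union> {x}" using Ceq nA xy(2) by auto
  \<comment> \<open>Both terms contain the product of \<open>f (A \<union> {x})\<close> and
    \<open>f (A \<union> {y})\<close>. Their signs differ because exactly one of
    \<open>x < y\<close> and \<open>y < x\<close> holds.\<close>
  ultimately show ?thesis
    using xy nA C(1) unfolding \<open>B = C\<close>
    by (subst pairing_eq_sum[OF C(1)])
      (auto simp: rel_sign_eq Ceq sgn_at_insert mult_ac)
qed

section \<open>Exchange arguments in a saturated ideal\<close>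

text \<open>\<open>K\<close> plays the part of the polynomial ring in the relevant variables, a subring of the type.\<close>

locale saturated_ideal =
  fixes K :: "'a::comm_ring_1 set" and S :: "'a set" and q :: 'a
  assumes K_0: "0 \<in> K" and K_1: "1 \<in> K"
    and K_add: "x \<in> K \<Longrightarrow> y \<in> K \<Longrightarrow> x + y \<in> K"
    and K_mult: "x \<in> K \<Longrightarrow> y \<in> K \<Longrightarrow> x * y \<in> K"
    and K_uminus: "x \<in> K \<Longrightarrow> - x \<in> K"
    and S_0: "0 \<in> S"
    and S_add: "x \<in> S \<Longrightarrow> y \<in> S \<Longrightarrow> x + y \<in> S"
    and S_mult: "k \<in> K \<Longrightarrow> x \<in> S \<Longrightarrow> k * x \<in> S"
    and q_cancel: "x \<in> K \<Longrightarrow> q * x \<in> S \<Longrightarrow> x \<in> S"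
begin

lemma S_uminus: "x \<in> S \<Longrightarrow> - x \<in> S"
  using S_mult[of "- 1" x] K_uminus K_1 by simp

lemma S_diff: "x \<in> S \<Longrightarrow> y \<in> S \<Longrightarrow> x - y \<in> S"
  using S_add[of x "- y"] S_uminus by simp

lemma S_sum: "(\<And>i. i \<in> I \<Longrightarrow> f i \<in> S) \<Longrightarrow> sum f I \<in> S"
  by (induction I rule: infinite_finite_induct) (auto simp: S_0 S_add)

lemma K_sum: "(\<And>i. i \<in> I \<Longrightarrow> f i \<in> K) \<Longrightarrow> sum f I \<in> K"
  by (induction I rule: infinite_finite_induct) (auto simp: K_0 K_add)

lemma K_sgn_at: "sgn_at i T \<in> K"
  using K_1 K_uminus by (cases "even (card ({1..i} \<inter> T))") (auto simp: sgn_at_def)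

lemma contract_in_K: "(\<And>T. f T \<in> K) \<Longrightarrow> contract i f D \<in> K"
  by (simp add: contract_def K_0 K_mult K_sgn_at)

lemma ext_mult_in_K: "(\<And>T. f T \<in> K) \<Longrightarrow> ext_mult i f D \<in> K"
  by (simp add: ext_mult_def K_0 K_mult K_sgn_at)

lemma contract_in_S: "(\<And>T. f T \<in> S) \<Longrightarrow> contract i f D \<in> S"
  by (simp add: contract_def S_0 S_mult K_sgn_at)

lemma ext_mult_in_S: "(\<And>T. f T \<in> S) \<Longrightarrow> ext_mult i f D \<in> S"
  by (simp add: ext_mult_def S_0 S_mult K_sgn_at)

lemma pairing_in_K: "(\<And>T. f T \<in> K) \<Longrightarrow> (\<And>T. g T \<in> K) \<Longrightarrow> pairing n f g D E \<in> K"
  unfolding pairing_def by (intro K_sum K_mult contract_in_K ext_mult_in_K)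

lemma pairing_in_S_left: "(\<And>T. f T \<in> S) \<Longrightarrow> (\<And>T. g T \<in> K) \<Longrightarrow> pairing n f g D E \<in> S"
  unfolding pairing_def
  by (subst mult.commute, intro S_sum S_mult contract_in_S ext_mult_in_K)

lemma pairing_in_S_right: "(\<And>T. f T \<in> K) \<Longrightarrow> (\<And>T. g T \<in> S) \<Longrightarrow> pairing n f g D E \<in> S"
  unfolding pairing_def by (intro S_sum S_mult contract_in_K ext_mult_in_S)

text \<open>Each step exchanges an element of \<open>T\<close> outside \<open>C\<close> for one of \<open>C\<close>, at the cost of a factor \<open>q\<close>.\<close>

lemma exchange_in_S:
  assumes fK: "\<And>T. f T \<in> K"
    and mK: "\<And>j c. m j c \<in> K"
    and red: "\<And>j D. j \<in> {1..n} - C \<Longrightarrow> contract_comb q m C j f D \<in> S"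
    and C: "C \<subseteq> {1..n}"
    and base: "\<And>T. T \<subseteq> C \<Longrightarrow> f T \<in> S"
    and T: "T \<subseteq> {1..n}"
  shows "f T \<in> S"
  using T
proof (induction "card (T - C)" arbitrary: T rule: less_induct)
  case less
  show ?case
  proof (cases "T \<subseteq> C")
    case True
    then show ?thesis by (rule base)
  next
    case False
    then obtain j where j: "j \<in> T" "j \<notin> C" by auto
    define D where "D = T - {j}"
    have fin: "finite T" using less.prems by (rule finite_subset) simp
    have "contract c f D \<in> S" if "c \<in> C" for c
    proof -
      \<comment> \<open>The new element \<open>c\<close> lies in \<open>C\<close>, while
        \<open>j\<close> has been lost outside \<open>C\<close>.\<close>
      have "insert c D - C \<subset> T - C" using j that by (auto simp: D_def)
      then have "card (insert c D - C) < card (T - C)"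
        using fin by (intro psubset_card_mono) auto
      moreover have "insert c D \<subseteq> {1..n}" using that C less.prems by (auto simp: D_def)
      ultimately have "f (insert c D) \<in> S" using less.hyps by blast
      then show ?thesis by (simp add: contract_def S_0 S_mult K_sgn_at)
    qed
    then have "(\<Sum>c\<in>C. m j c * contract c f D) \<in> S" by (intro S_sum S_mult mK)
    \<comment> \<open>Adding the sum back leaves \<open>q * contract j f D\<close>; once
      \<open>q\<close> is cancelled, this is \<open>f T\<close> up to sign.\<close>
    moreover have "contract_comb q m C j f D \<in> S" using j less.prems by (intro red) auto
    ultimately have "q * contract j f D \<in> S"
      using S_add unfolding contract_comb_def by fastforce
    then have "contract j f D \<in> S" by (rule q_cancel[OF contract_in_K[OF fK]])
    then have "sgn_at j D * contract j f D \<in> S" by (intro S_mult K_sgn_at)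
    then show ?thesis using j by (simp add: contract_def D_def insert_absorb)
  qed
qed

text \<open>The exchange is made twice: first in \<open>A\<close> with the second set inside
  \<open>C\<close>, then in \<open>B\<close> with \<open>A\<close> fixed, the first result serving
  as base case.\<close>

lemma pairing_self_in_S:
  assumes fK: "\<And>T. f T \<in> K"
    and mK: "\<And>j c. m j c \<in> K"
    and red: "\<And>j D. j \<in> {1..n} - C \<Longrightarrow> contract_comb q m C j f D \<in> S"
    and card_f: "\<And>T. card T \<noteq> d \<Longrightarrow> f T = 0"
    and C: "C \<subseteq> {1..n}" "card C = d + 1"
    and A: "A \<subseteq> {1..n}" and B: "B \<subseteq> {1..n}"
  shows "pairing n f f A B \<in> S"
proof -
  have left: "pairing n f f A B' \<in> S" if B': "B' \<subseteq> C" for B'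
  proof (rule exchange_in_S[where f = "\<lambda>A. pairing n f f A B'", OF _ mK _ C(1) _ A])
    show "contract_comb q m C j (\<lambda>A. pairing n f f A B') D \<in> S" if "j \<in> {1..n} - C" for j D
      using that C(1) by (simp add: contract_comb_pairing_left S_uminus pairing_in_S_left red fK)
    show "pairing n f f T B' \<in> S" if "T \<subseteq> C" for T
      using pairing_self_eq_0[OF card_f C that B'] by (simp add: S_0)
  qed (intro pairing_in_K fK)
  show ?thesis
  proof (rule exchange_in_S[where f = "pairing n f f A", OF _ mK _ C(1) left B])
    fix j D assume "j \<in> {1..n} - C"
    \<comment> \<open>The extra product in \<open>contract_comb_pairing_right\<close> has the factor
      \<open>contract_comb q m C j f A\<close>, which is in \<open>S\<close> by
      \<open>red\<close>.\<close>
    then show "contract_comb q m C j (pairing n f f A) D \<in> S"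
      using C(1) S_mult[OF fK red, of j D A]
      by (simp add: contract_comb_pairing_right S_uminus S_diff pairing_in_S_right red fK mult.commute)
  qed (intro pairing_in_K fK)
qed

lemma pairing_self_in_S_if_incident:
  assumes fK: "\<And>T. f T \<in> K" and gK: "\<And>T. g T \<in> K"
    and incident: "\<And>D E. E \<subseteq> {1..n} \<Longrightarrow> card E = d + 2 \<Longrightarrow> pairing n f g D E \<in> S"
    and q: "g C = q"
    and card_f: "\<And>T. card T \<noteq> d \<Longrightarrow> f T = 0"
    and C: "C \<subseteq> {1..n}" "card C = d + 1"
    and A: "A \<subseteq> {1..n}" and B: "B \<subseteq> {1..n}"
  shows "pairing n f f A B \<in> S"
proof -
  \<comment> \<open>Chosen so that the incidence relation at \<open>insert j C\<close>, multiplied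
    by \<open>sgn_at j (insert j C)\<close>, is exactly \<open>contract_comb q m C j f\<close>:
    removing \<open>j\<close> leaves \<open>g C = q\<close> as leading coefficient.\<close>
  define m where "m j c = - (sgn_at j (insert j C) * ext_mult c g (insert j C))" for j c
  have fin: "finite C" using C(1) by (rule finite_subset) simp
  have "contract_comb q m C j f D \<in> S" if j: "j \<in> {1..n} - C" for j D
  proof -
    let ?E = "insert j C"
    have "pairing n f g D ?E = (\<Sum>i\<in>?E. contract i f D * ext_mult i g ?E)"
      unfolding pairing_def using j C(1)
      by (intro sum.mono_neutral_right) (auto simp: ext_mult_def)
    also have "\<dots> = sgn_at j ?E * q * contract j f D + (\<Sum>c\<in>C. contract c f D * ext_mult c g ?E)"
      using j fin q by (simp add: ext_mult_def[of j] mult_ac)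
    finally have "sgn_at j ?E * pairing n f g D ?E = contract_comb q m C j f D"
      by (simp add: contract_comb_def m_def sum_negf sum_distrib_left distrib_left mult_ac)
    moreover have "pairing n f g D ?E \<in> S" using j C fin by (intro incident) auto
    ultimately show ?thesis using S_mult[OF K_sgn_at] by metis
  qed
  moreover have "m j c \<in> K" for j c
    unfolding m_def by (intro K_uminus K_mult K_sgn_at ext_mult_in_K gK)
  ultimately show ?thesis by (intro pairing_self_in_S[OF fK _ _ card_f C A B])
qed

end

section \<open>Saturations in the polynomial ring\<close>

lemma nat_pow_poly_ring: "f [^]\<^bsub>poly_ring V\<^esub> (N::nat) = f ^ N"
  by (induction N) (simp_all add: poly_ring_def nat_pow_def mult.commute)

text \<open>Exponents \<open>M\<close> and \<open>N\<close> for two elements give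
  \<open>M + N\<close> for their sum, and an exponent \<open>M\<close> for \<open>q * x\<close>
  gives \<open>Suc M\<close> for \<open>x\<close>.\<close>

lemma saturated_ideal_saturation:
  fixes V :: "'v set" and q :: "('v, 'k::comm_ring_1) mvpoly"
  assumes "ideal I (poly_ring V)" and q: "q \<in> carrier (poly_ring V)"
  shows "saturated_ideal (carrier (poly_ring V)) (saturation (poly_ring V) I q) q"
proof -
  let ?R = "poly_ring V :: ('v, 'k) mvpoly ring"
  let ?S = "saturation ?R I q"
  interpret R: cring ?R by (rule cring_poly_ring)
  interpret I: ideal I ?R by fact
  have zero [simp]: "\<zero>\<^bsub>?R\<^esub> = 0" and one [simp]: "\<one>\<^bsub>?R\<^esub> = 1"
    and add [simp]: "x \<oplus>\<^bsub>?R\<^esub> y = x + y" and mult [simp]: "x \<otimes>\<^bsub>?R\<^esub> y = x * y" for x y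
    by (simp_all add: poly_ring_def)
  have S: "x \<in> ?S \<longleftrightarrow> x \<in> carrier ?R \<and> (\<exists>N. q ^ N * x \<in> I)" for x
    by (simp add: saturation_def nat_pow_poly_ring)
  have mult_closed: "x * y \<in> carrier ?R" if "x \<in> carrier ?R" "y \<in> carrier ?R" for x y
    using R.m_closed[OF that] by simp
  have add_closed: "x + y \<in> carrier ?R" if "x \<in> carrier ?R" "y \<in> carrier ?R" for x y
    using R.a_closed[OF that] by simp
  have I_add: "x + y \<in> I" if "x \<in> I" "y \<in> I" for x y
    using I.a_closed[OF that] by simp
  have I_mult: "k * x \<in> I" if "k \<in> carrier ?R" "x \<in> I" for k x
    using I.I_l_closed[OF that(2,1)] by simp
  have q_pow: "q ^ N \<in> carrier ?R" for N
    using R.nat_pow_closed[OF q, of N] by (simp add: nat_pow_poly_ring)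
  show ?thesis
  proof
    show "0 \<in> carrier ?R" "1 \<in> carrier ?R" using R.zero_closed R.one_closed by simp_all
    show "- x \<in> carrier ?R" if "x \<in> carrier ?R" for x
      using that by (simp add: poly_ring_def)
    show "0 \<in> ?S" using R.zero_closed I.zero_closed by (simp add: S)
    show "x + y \<in> ?S" if x: "x \<in> ?S" and y: "y \<in> ?S" for x y
    proof -
      obtain M N where MN: "q ^ M * x \<in> I" "q ^ N * y \<in> I" using x y S by blast
      have "q ^ N * (q ^ M * x) + q ^ M * (q ^ N * y) \<in> I"
        by (rule I_add[OF I_mult[OF q_pow MN(1)] I_mult[OF q_pow MN(2)]])
      then have "q ^ (M + N) * (x + y) \<in> I" by (simp add: power_add algebra_simps)
      then show ?thesis using x y S add_closed by blast
    qed
    show "k * x \<in> ?S" if k: "k \<in> carrier ?R" and x: "x \<in> ?S" for k x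
    proof -
      obtain M where "q ^ M * x \<in> I" using x S by blast
      then have "q ^ M * (k * x) \<in> I" using I_mult[OF k] by (metis mult.left_commute)
      then show ?thesis using x k S mult_closed by blast
    qed
    show "x \<in> ?S" if x: "x \<in> carrier ?R" and qx: "q * x \<in> ?S" for x
    proof -
      obtain M where "q ^ M * (q * x) \<in> I" using qx S by blast
      then have "q ^ Suc M * x \<in> I" by (simp add: mult_ac)
      then show ?thesis using x S by blast
    qed
  qed (fact add_closed mult_closed)+
qed

section \<open>Application to the coordinate variables\<close>

theorem theorem3:
  fixes d n :: nat and A B C :: "nat set"
  assumes "n \<ge> d + 1"
    and "C \<in> subsets_of_card n (int d + 1)"
    and "A \<in> subsets_of_card n (int d - 1)"
    and "B \<in> subsets_of_card n (int d + 1)"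
  shows "(plucker_rel A B :: (coord, 'k::alg_closed_field) mvpoly)
    \<in> saturation (poly_ring (coords n d)) (incidence_ideal n d) (var (Qc C))"
proof -
  let ?R = "poly_ring (coords n d) :: (coord, 'k) mvpoly ring"
  let ?q = "var (Qc C) :: (coord, 'k) mvpoly"
  let ?I = "incidence_ideal n d :: (coord, 'k) mvpoly set"
  let ?S = "saturation ?R ?I ?q"
  \<comment> \<open>Extension by zero keeps all values in the carrier and makes \<open>P\<close>
    vanish off sets of size \<open>d\<close>.\<close>
  define P :: "nat set \<Rightarrow> (coord, 'k) mvpoly"
    where "P T = (if T \<in> subsets_of_card n (int d) then var (Pc T) else 0)" for T
  define Q :: "nat set \<Rightarrow> (coord, 'k) mvpoly"
    where "Q T = (if T \<in> subsets_of_card n (int d + 1) then var (Qc T) else 0)" for T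
  have PK: "P T \<in> carrier ?R" and QK: "Q T \<in> carrier ?R" for T
    by (auto simp: P_def Q_def poly_ring_def vars_var coords_def)
  have QC: "Q C = ?q" using assms(2) by (simp add: Q_def)
  interpret R: cring ?R by (rule cring_poly_ring)
  have ideal: "ideal ?I ?R"
    unfolding incidence_ideal_def by (rule R.genideal_ideal[OF incidence_rels_closed])
  interpret saturated_ideal "carrier ?R" ?S ?q
    using saturated_ideal_saturation[OF ideal] QK[of C] QC by simp
  have I_S: "x \<in> ?S" if "x \<in> ?I" for x
  proof -
    have "?q [^]\<^bsub>?R\<^esub> (0::nat) \<otimes>\<^bsub>?R\<^esub> x = x"
      by (simp add: nat_pow_poly_ring) (simp add: poly_ring_def)
    moreover have "x \<in> carrier ?R"
      using that ideal additive_subgroup.a_subset ideal.axioms(1) by blast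
    ultimately show ?thesis
      using that unfolding saturation_def by (metis (mono_tags, lifting) mem_Collect_eq)
  qed
  have P_insert: "P (D \<union> {i}) = var (Pc (D \<union> {i}))"
    if "D \<in> subsets_of_card n (int d - 1)" "i \<in> {1..n} - D" for D i
  proof -
    have "finite D" using that by (auto simp: subsets_of_card_def intro: finite_subset)
    then show ?thesis using that by (auto simp: P_def subsets_of_card_def)
  qed
  have remove: "E - {i} \<in> subsets_of_card n k"
    if "E \<in> subsets_of_card n (k + 1)" "i \<in> E" for E i k
  proof -
    have "finite E" using that by (auto simp: subsets_of_card_def intro: finite_subset)
    then have "card (E - {i}) + 1 = card E" using that card_Suc_Diff1[of E i] by simp
    then show ?thesis using that by (auto simp: subsets_of_card_def)
  qed
  have "pairing n P Q D E \<in> ?S" if E: "E \<subseteq> {1..n}" "card E = d + 2" for D E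
  proof (cases "D \<in> subsets_of_card n (int d - 1)")
    case True
    have E': "E \<in> subsets_of_card n (int d + 2)" using E by (simp add: subsets_of_card_def)
    have "pairing n P Q D E = incidence_rel D E"
      unfolding pairing_eq_sum[OF E(1)] incidence_rel_def
    proof (intro sum.cong refl)
      fix i assume i: "i \<in> E - D"
      have "E - {i} \<in> subsets_of_card n (int d + 1)" using i E' by (intro remove) (auto simp: add.commute)
      then show "rel_sign i D E * Q (E - {i}) * P (D \<union> {i})
          = rel_sign i D E * var (Qc (E - {i})) * var (Pc (D \<union> {i}))"
        using i E P_insert[OF True, of i] by (auto simp: Q_def)
    qed
    moreover have "incidence_rel D E \<in> (incidence_rels n d :: (coord, 'k) mvpoly set)"
      using True E' by (auto simp: incidence_rels_def)
    ultimately have "pairing n P Q D E \<in> ?I"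
      using R.genideal_self[OF incidence_rels_closed] by (auto simp: incidence_ideal_def)
    then show ?thesis by (rule I_S)
  next
    case False
    \<comment> \<open>No \<open>insert i D\<close> with \<open>i \<notin> D\<close> indexes a
      variable, so the pairing is zero. For \<open>d = 0\<close> every \<open>D\<close> falls under
      this case.\<close>
    have "contract i P D = 0" for i
    proof (cases "i \<in> D")
      case iD: False
      have "insert i D \<notin> subsets_of_card n (int d)"
      proof
        assume *: "insert i D \<in> subsets_of_card n (int d)"
        then have "finite D" by (auto simp: subsets_of_card_def intro: finite_subset)
        with * iD False show False by (auto simp: subsets_of_card_def)
      qed
      then show ?thesis by (simp add: contract_def P_def)
    qed (simp add: contract_def)
    then show ?thesis by (simp add: pairing_def S_0)
  qed
  then have "pairing n P P A B \<in> ?S"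
    using assms by (intro pairing_self_in_S_if_incident[where g = Q and d = d and C = C] PK QK QC)
      (auto simp: P_def subsets_of_card_def)
  moreover have "pairing n P P A B = plucker_rel A B"
  proof -
    have B: "B \<subseteq> {1..n}" using assms(4) by (simp add: subsets_of_card_def)
    show ?thesis unfolding pairing_eq_sum[OF B] plucker_rel_def
    proof (intro sum.cong refl)
      fix i assume i: "i \<in> B - A"
      have "B - {i} \<in> subsets_of_card n (int d)" using i assms(4) by (intro remove) auto
      then show "rel_sign i A B * P (B - {i}) * P (A \<union> {i})
          = rel_sign i A B * var (Pc (A \<union> {i})) * var (Pc (B - {i}))"
        using i B P_insert[OF assms(3), of i] by (auto simp: P_def mult_ac)
    qed
  qed
  ultimately show ?thesis by simp
qed

end
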